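(* For $k \geq 2$, \[ ex(n;C_{k+1};k) \leq \sum_{i=1}^{n} i^{1/k} = \frac{k}{k+1}n^{\frac{k+1}{k}} + O(n^{\frac{1}{k}}). \]
   Context: A digraph has a vertex set and an arc set consisting of ordered pairs of distinct vertices. A walk of length $\ell$ is a sequence $x_0x_1\dots x_\ell$ of vertices with $x_i \rightarrow x_{i+1}$ for all $i$. A digraph is $k$-geodetic if for every ordered pair $(u,v)$ of (not necessarily distinct) vertices there is at most one $u,v$-walk of length at most $k$. $C_{k+1}$ denotes the directed cycle of length $k+1$. For a digraph $Z$ and $k\ge 2$, $ex(n;Z;k)$ is the largest number of copies of $Z$ (subdigraphs isomorphic to $Z$) in a $k$-geodetic digraph with $n$ vertices. *)

theory Defs
  imports
    Complex_Main
    "HOL-Library.Landau_Symbols"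
    "Graph_Theory.Graph_Theory"
begin

text \<open>
  The digraphs considered are those satisfying \<open>pair_digraph\<close>: finitely many vertices, and a set
  of arcs that are ordered pairs of distinct vertices.
\<close>

text \<open>
  The walk \<open>[x\<^sub>0, \<dots>, x\<^sub>l]\<close> has length \<open>l\<close>, so for \<open>u = v\<close> the trivial walk \<open>[u]\<close> of length 0 is the
  only one allowed: a \<open>k\<close>-geodetic digraph has no closed walk of length between 1 and \<open>k\<close>.
\<close>

definition k_geodetic :: "nat \<Rightarrow> 'a pair_pre_digraph \<Rightarrow> bool" where
  "k_geodetic k G \<longleftrightarrow>
     (\<forall>u \<in> pverts G. \<forall>v \<in> pverts G.
        \<exists>\<^sub>\<le>\<^sub>1 p. vwalk p (with_proj G) \<and> hd p = u \<and> last p = v \<and> vwalk_length p \<le> k)"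

definition dicycle :: "nat \<Rightarrow> nat pair_pre_digraph" where
  "dicycle m = \<lparr> pverts = {..<m}, parcs = {(i, Suc i mod m) | i. i < m} \<rparr>"

definition copies :: "'b pair_pre_digraph \<Rightarrow> 'a pair_pre_digraph \<Rightarrow> 'a pair_pre_digraph set" where
  "copies Z G = {H. subgraph (with_proj H) (with_proj G) \<and> digraph_iso (with_proj Z) (with_proj H)}"

text \<open>
  Every finite digraph is isomorphic to one whose vertices are natural numbers, and the number of
  copies is invariant under isomorphism, so it suffices to let the host digraph range over those.
\<close>

definition copy_numbers :: "nat \<Rightarrow> 'b pair_pre_digraph \<Rightarrow> nat \<Rightarrow> nat set" where
  "copy_numbers n Z k =
     {card (copies Z G) | G :: nat pair_pre_digraph.
        pair_digraph G \<and> card (pverts G) = n \<and> k_geodetic k G}"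

definition ex :: "nat \<Rightarrow> 'b pair_pre_digraph \<Rightarrow> nat \<Rightarrow> nat" where
  "ex n Z k = Max (copy_numbers n Z k)"

text \<open>The maximum is taken over a finite nonempty set, hence is meaningful for all arguments.\<close>

lemma copies_card_le:
  assumes "pair_digraph G"
  shows "finite (copies Z G)"
    and "card (copies Z G) \<le> 2 ^ card (pverts G) * 2 ^ (card (pverts G) * card (pverts G))"
proof -
  interpret pair_digraph G by fact
  let ?V = "pverts G"
  let ?f = "\<lambda>H :: 'a pair_pre_digraph. (pverts H, parcs H)"
  have fin: "finite (Pow ?V \<times> Pow (?V \<times> ?V))"
    using pair_finite_verts by simp
  have inj: "inj_on ?f (copies Z G)"
    by (rule inj_onI) (simp add: pair_pre_digraph.equality)
  have "parcs G \<subseteq> ?V \<times> ?V"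
    by (auto dest: in_arcsD1 in_arcsD2)
  then have sub: "?f ` copies Z G \<subseteq> Pow ?V \<times> Pow (?V \<times> ?V)"
    unfolding copies_def subgraph_def with_proj_simps by blast
  show "finite (copies Z G)"
    using finite_imageD[OF finite_subset[OF sub fin] inj] .
  have "card (copies Z G) \<le> card (Pow ?V \<times> Pow (?V \<times> ?V))"
    by (rule card_inj_on_le[OF inj sub fin])
  then show "card (copies Z G) \<le> 2 ^ card ?V * 2 ^ (card ?V * card ?V)"
    using pair_finite_verts by (simp add: card_cartesian_product card_Pow)
qed

lemma finite_copy_numbers: "finite (copy_numbers n Z k)"
proof (rule finite_subset)
  show "copy_numbers n Z k \<subseteq> {..2 ^ n * 2 ^ (n * n)}"
    unfolding copy_numbers_def using copies_card_le(2) by blast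
qed simp

lemma copy_numbers_nonempty: "copy_numbers n Z k \<noteq> {}"
proof -
  let ?G = "\<lparr> pverts = {..<n}, parcs = {} \<rparr> :: nat pair_pre_digraph"
  have "pair_digraph ?G"
    by unfold_locales auto
  moreover have "k_geodetic k ?G"
  proof -
    have "p = [hd p]" if "vwalk p (with_proj ?G)" for p
      using that by (cases p rule: vwalk_arcs.cases) (auto simp: vwalk_def)
    then show ?thesis
      unfolding k_geodetic_def Uniq_def by metis
  qed
  ultimately show ?thesis
    unfolding copy_numbers_def by fastforce
qed

end

(*
  In a k-geodetic digraph of order n some vertex v has out-degree d with d^k \<le> n, since the walks
  of length k from a fixed vertex have pairwise distinct ends. A directed (k+1)-cycle through v is
  determined by the arc by which it leaves v, because the rest of it is a walk of length k back to
  v. So v lies on at most n^(1/k) such cycles; delete v and induct.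
*)
theory Submission
  imports Defs
begin

section \<open>Walks in geodetic digraphs\<close>

lemma pair_digraphD:
  assumes "pair_digraph G"
  shows "finite (pverts G)" "finite (parcs G)"
    and "(u, v) \<in> parcs G \<Longrightarrow> u \<in> pverts G" "(u, v) \<in> parcs G \<Longrightarrow> v \<in> pverts G"
    and "(u, v) \<in> parcs G \<Longrightarrow> u \<noteq> v"
  using assms
  unfolding pair_digraph_def pair_fin_digraph_def pair_fin_digraph_axioms_def pair_wf_digraph_def
    pair_loopfree_digraph_def pair_loopfree_digraph_axioms_def
  by force+

lemma vwalk_snocI:
  assumes "vwalk p G" "w \<in> verts G" "(last p, w) \<in> arcs_ends G"
  shows "vwalk (p @ [w]) G"
  using assms by (auto simp: vwalk_def vwalk_arcs_append)

lemma vwalk_mapI: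
  assumes "\<And>i. i < m \<Longrightarrow> g i \<in> verts G" "\<And>i. Suc i < m \<Longrightarrow> (g i, g (Suc i)) \<in> arcs_ends G"
    and "0 < m"
  shows "vwalk (map g [0..<m]) G"
proof -
  \<comment> \<open>The induction runs over nonempty prefixes, as the empty list is not a
    walk.\<close>
  have "vwalk (map g [0..<Suc n]) G" if "n < m" for n
    using that
  proof (induction n)
    case 0
    then show ?case using assms(1) by simp
  next
    case (Suc n)
    have "vwalk (map g [0..<Suc n] @ [g (Suc n)]) G"
    proof (rule vwalk_snocI)
      show "vwalk (map g [0..<Suc n]) G"
        using Suc by simp
      show "g (Suc n) \<in> verts G" "(last (map g [0..<Suc n]), g (Suc n)) \<in> arcs_ends G"
        using assms(1,2) Suc.prems by simp_all
    qed
    then show ?case by simp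
  qed
  from this[of "m - 1"] show ?thesis
    using \<open>0 < m\<close> by simp
qed

text \<open>The usable form of geodeticity: the ends of a walk are vertices anyway, and a list of
  \<open>Suc k\<close> vertices is a walk of length \<open>k\<close>.\<close>

lemma k_geodetic_unique:
  assumes "k_geodetic k G" "vwalk p G" "vwalk q G" "hd p = hd q" "last p = last q"
    and "length p \<le> Suc k" "length q \<le> Suc k"
  shows "p = q"
proof -
  have "hd p \<in> pverts G" "last p \<in> pverts G"
    using assms(2) by (auto simp: vwalk_def dest: hd_in_set last_in_set)
  then have "\<exists>\<^sub>\<le>\<^sub>1 r. vwalk r (with_proj G) \<and> hd r = hd p \<and> last r = last p \<and> vwalk_length r \<le> k"
    using assms(1) unfolding k_geodetic_def by blast
  then show ?thesis
    by (rule Uniq_D) (use assms in auto)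
qed

section \<open>Counting walks by out-degree\<close>

definition walks_from :: "'a pair_pre_digraph \<Rightarrow> 'a \<Rightarrow> nat \<Rightarrow> 'a list set" where
  "walks_from G v j = {p. vwalk p (with_proj G) \<and> hd p = v \<and> length p = Suc j}"

lemma finite_walks_from:
  assumes "pair_digraph G"
  shows "finite (walks_from G v j)"
proof (rule finite_subset)
  show "walks_from G v j \<subseteq> {p. set p \<subseteq> pverts G \<and> length p = Suc j}"
    by (auto simp: walks_from_def vwalk_def)
  show "finite {p. set p \<subseteq> pverts G \<and> length p = Suc j}"
    using finite_lists_length_eq[OF pair_digraphD(1)[OF assms]] .
qed

lemma finite_out_neighbours: "pair_digraph G \<Longrightarrow> finite (parcs G `` {u})"
  by (rule finite_Image) (rule pair_digraphD(2))

text \<open>Each walk of length \<open>j\<close> extends by any out-neighbour of its last vertex,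
  hence in at least \<open>d\<close> ways, and distinct choices give distinct lists.\<close>

lemma card_walks_from_ge:
  assumes "pair_digraph G" "v \<in> pverts G" "\<And>u. u \<in> pverts G \<Longrightarrow> d \<le> card (parcs G `` {u})"
  shows "d ^ j \<le> card (walks_from G v j)"
proof (induction j)
  case 0
  have "[v] \<in> walks_from G v 0"
    using assms(2) by (simp add: walks_from_def vwalk_def)
  then have "card (walks_from G v 0) > 0"
    using finite_walks_from[OF assms(1)] card_gt_0_iff by blast
  then show ?case by simp
next
  case (Suc j)
  let ?S = "SIGMA p:walks_from G v j. parcs G `` {last p}"
  have last: "last p \<in> pverts G" if "p \<in> walks_from G v j" for p
    using that by (auto simp: walks_from_def vwalk_def)
  have "d ^ Suc j \<le> (\<Sum>p\<in>walks_from G v j. d)"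
    using Suc by simp
  also have "\<dots> \<le> (\<Sum>p\<in>walks_from G v j. card (parcs G `` {last p}))"
    using assms(3) last by (intro sum_mono) blast
  also have "\<dots> = card ?S"
    using finite_walks_from[OF assms(1)] finite_out_neighbours[OF assms(1)] by (subst card_SigmaI) auto
  also have "\<dots> \<le> card (walks_from G v (Suc j))"
  proof (rule card_inj_on_le[where f = "\<lambda>(p, w). p @ [w]"])
    show "(\<lambda>(p, w). p @ [w]) ` ?S \<subseteq> walks_from G v (Suc j)"
      by (auto simp: walks_from_def hd_append dest: pair_digraphD(4)[OF assms(1)] intro!: vwalk_snocI)
    show "inj_on (\<lambda>(p, w). p @ [w]) ?S"
      by (rule inj_onI) (simp add: case_prod_unfold prod_eq_iff)
  qed (rule finite_walks_from[OF assms(1)])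
  finally show ?case .
qed

text \<open>A vertex of minimum out-degree \<open>d\<close> serves both as the required vertex and
  as the start of at least \<open>d ^ k\<close> walks of length \<open>k\<close>; geodeticity makes
  \<open>last\<close> injective on these.\<close>

lemma k_geodetic_small_out_degree:
  assumes "pair_digraph G" "k_geodetic k G" "pverts G \<noteq> {}"
  obtains v where "v \<in> pverts G" "card (parcs G `` {v}) ^ k \<le> card (pverts G)"
proof -
  let ?v = "arg_min_on (\<lambda>v. card (parcs G `` {v})) (pverts G)"
  have v: "?v \<in> pverts G"
    using arg_min_if_finite(1)[OF pair_digraphD(1)[OF assms(1)] assms(3)] .
  have "card (parcs G `` {?v}) ^ k \<le> card (walks_from G ?v k)"
    by (rule card_walks_from_ge[OF assms(1) v arg_min_least[OF pair_digraphD(1)[OF assms(1)] assms(3)]])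
  also have "\<dots> \<le> card (pverts G)"
  proof (rule card_inj_on_le[where f = last])
    show "inj_on last (walks_from G ?v k)"
      by (rule inj_onI, rule k_geodetic_unique[OF assms(2)]) (simp_all add: walks_from_def)
    show "last ` walks_from G ?v k \<subseteq> pverts G"
      by (auto simp: walks_from_def vwalk_def)
  qed (rule pair_digraphD(1)[OF assms(1)])
  finally show thesis
    using v that by blast
qed

section \<open>Directed cycles through a vertex\<close>

text \<open>The list is read cyclically, so the arc from its last to its first entry is included.
  Indices run over all naturals, to match periodic sequences without a special case for the closing
  arc.\<close>

definition closed_walk_digraph :: "'a list \<Rightarrow> 'a pair_pre_digraph" where
  "closed_walk_digraph p =
     \<lparr> pverts = set p, parcs = range (\<lambda>i. (p ! (i mod length p), p ! (Suc i mod length p))) \<rparr>"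

text \<open>An isomorphism carries separate maps for vertices and arcs. Tail and head are
  \<open>fst\<close> and \<open>snd\<close> on both sides, which forces the arc map to be the vertex
  map taken componentwise.\<close>

lemma digraph_iso_with_proj:
  assumes "digraph_iso (with_proj Z) (with_proj H)"
  obtains f where "pverts H = f ` pverts Z" "parcs H = map_prod f f ` parcs Z"
proof -
  obtain h where h: "pre_digraph.digraph_isomorphism (with_proj Z) h"
    and eq: "with_proj H = app_iso h (with_proj Z)"
    using assms unfolding digraph_iso_def by blast
  have "fst = iso_tail h" "snd = iso_head h"
    using arg_cong[OF eq, of tail] arg_cong[OF eq, of head] by simp_all
  then have "iso_arcs h a = map_prod (iso_verts h) (iso_verts h) a" if "a \<in> parcs Z" for a
    using h that unfolding pre_digraph.digraph_isomorphism_def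
    by (auto simp: prod_eq_iff)
  then have "parcs H = map_prod (iso_verts h) (iso_verts h) ` parcs Z"
    using arg_cong[OF eq, of arcs] by auto
  moreover have "pverts H = iso_verts h ` pverts Z"
    using arg_cong[OF eq, of verts] by simp
  ultimately show thesis
    using that by blast
qed

text \<open>Indexing by all naturals turns a copy of the cycle into a periodic sequence, in which
  rotation is a shift of the index.\<close>

lemma dicycle_conv_range:
  assumes "m > 0"
  shows "pverts (dicycle m) = range (\<lambda>i. i mod m)"
    and "parcs (dicycle m) = range (\<lambda>i. (i mod m, Suc i mod m))"
proof -
  show "pverts (dicycle m) = range (\<lambda>i. i mod m)"
    using assms by (auto simp: dicycle_def image_iff) (metis mod_less)
  show "parcs (dicycle m) = range (\<lambda>i. (i mod m, Suc i mod m))"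
  proof (intro subset_antisym subsetI)
    fix a assume "a \<in> parcs (dicycle m)"
    then obtain i where "i < m" "a = (i, Suc i mod m)"
      by (auto simp: dicycle_def)
    then have "a = (i mod m, Suc i mod m)" by simp
    then show "a \<in> range (\<lambda>i. (i mod m, Suc i mod m))" by blast
  next
    fix a assume "a \<in> range (\<lambda>i. (i mod m, Suc i mod m))"
    then obtain i where "a = (i mod m, Suc (i mod m) mod m)"
      by (auto simp: mod_Suc_eq)
    then show "a \<in> parcs (dicycle m)"
      using assms by (auto simp: dicycle_def)
  qed
qed

text \<open>The cycle is rotated so that its list of vertices starts right after \<open>v\<close>
  and ends at \<open>v\<close>. The arc leaving \<open>v\<close> then closes the walk, and the list
  alone determines the copy.\<close>

lemma dicycle_copy_through:
  assumes "H \<in> copies (dicycle m) G" "v \<in> pverts H" "m > 0"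
  obtains p where "vwalk p (with_proj G)" "length p = m" "last p = v" "(v, hd p) \<in> parcs G"
    "H = closed_walk_digraph p"
proof -
  have sub: "pverts H \<subseteq> pverts G" "parcs H \<subseteq> parcs G"
    and iso: "digraph_iso (with_proj (dicycle m)) (with_proj H)"
    using assms(1) by (auto simp: copies_def subgraph_def)
  obtain f0 where f0: "pverts H = f0 ` pverts (dicycle m)"
      "parcs H = map_prod f0 f0 ` parcs (dicycle m)"
    using digraph_iso_with_proj[OF iso] .
  define f where "f i = f0 (i mod m)" for i
  have H: "pverts H = range f" "parcs H = range (\<lambda>i. (f i, f (Suc i)))"
    using f0 by (simp_all add: dicycle_conv_range[OF assms(3)] f_def image_image)
  have per: "f (i + m * c) = f i" for i c
    by (simp add: f_def)
  obtain j where j: "v = f j"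
    using assms(2) H(1) by blast
  \<comment> \<open>The offset \<open>Suc j\<close> makes \<open>g 0\<close> the successor of
    \<open>v\<close> and \<open>g (m - 1) = f (j + m) = v\<close>.\<close>
  define g where "g i = f (i + Suc j)" for i
  \<comment> \<open>Going back by \<open>Suc j\<close> is replaced by going forward by
    \<open>(m - 1) * Suc j\<close>: the two offsets add up to \<open>m * Suc j\<close>, a multiple
    of the period.\<close>
  have shift: "f i = g (i + (m - 1) * Suc j) \<and> f (Suc i) = g (Suc i + (m - 1) * Suc j)" for i
  proof -
    have "(m - 1) * Suc j + Suc j = m * Suc j"
      using assms(3) by (metis Suc_pred' add.commute mult_Suc)
    then show ?thesis
      unfolding g_def by (metis add.assoc per)
  qed
  have Hg: "pverts H = range g" "parcs H = range (\<lambda>i. (g i, g (Suc i)))"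
  proof -
    show "pverts H = range g"
      unfolding H(1) using shift by (auto simp: g_def)
    have "(g i, g (Suc i)) = (f (i + Suc j), f (Suc (i + Suc j)))" for i
      by (simp add: g_def)
    moreover have "(f i, f (Suc i)) =
        (g (i + (m - 1) * Suc j), g (Suc (i + (m - 1) * Suc j)))" for i
      using shift[of i] by simp
    ultimately show "parcs H = range (\<lambda>i. (g i, g (Suc i)))"
      unfolding H(2) by (intro subset_antisym image_subsetI) (metis (lifting) rangeI)+
  qed
  have gmod: "g (i mod m) = g i" for i
    unfolding g_def f_def by (metis mod_add_left_eq)
  let ?p = "map g [0..<m]"
  have nth: "?p ! (i mod m) = g i" for i
    using assms(3) gmod by simp
  have "H = closed_walk_digraph ?p"
  proof -
    have "set ?p = range g"
      using assms(3) gmod by (auto simp: image_iff) (metis mod_less_divisor atLeastLessThan_iff zero_le)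
    then show ?thesis
      using Hg nth by (intro pair_pre_digraph.equality) (simp_all add: closed_walk_digraph_def)
  qed
  moreover have "vwalk ?p (with_proj G)"
    using sub Hg assms(3) by (intro vwalk_mapI) auto
  moreover have "last ?p = v"
  proof -
    have "last ?p = f (j + m * 1)"
      using assms(3) by (simp add: last_map g_def add.commute)
    then show ?thesis
      using per j by metis
  qed
  moreover have "(v, hd ?p) \<in> parcs G"
  proof -
    have "hd ?p = f (Suc j)"
      using assms(3) by (simp add: hd_map g_def)
    then show ?thesis
      using sub(2) H(2) j by auto
  qed
  ultimately show thesis
    using that[of ?p] by simp
qed

text \<open>Each copy yields a walk of length \<open>k\<close> from an out-neighbour of
  \<open>v\<close> to \<open>v\<close>. By geodeticity its first vertex determines the walk, and
  hence the copy.\<close>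

lemma card_dicycle_copies_through:
  assumes "pair_digraph G" "k_geodetic k G"
  shows "card {H \<in> copies (dicycle (k + 1)) G. v \<in> pverts H} \<le> card (parcs G `` {v})"
proof -
  let ?C = "{H \<in> copies (dicycle (k + 1)) G. v \<in> pverts H}"
  let ?P = "\<lambda>H p. vwalk p (with_proj G) \<and> length p = k + 1 \<and> last p = v \<and> (v, hd p) \<in> parcs G \<and>
    H = closed_walk_digraph p"
  have "\<forall>H\<in>?C. \<exists>p. ?P H p"
  proof
    fix H assume "H \<in> ?C"
    then have "H \<in> copies (dicycle (k + 1)) G" "v \<in> pverts H" "0 < k + 1"
      by auto
    then show "\<exists>p. ?P H p"
      by (rule dicycle_copy_through) blast
  qed
  from bchoice[OF this] obtain w where w: "\<forall>H\<in>?C. ?P H (w H)" ..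
  show ?thesis
  proof (rule card_inj_on_le[where f = "\<lambda>H. hd (w H)"])
    show "inj_on (\<lambda>H. hd (w H)) ?C"
    proof (rule inj_onI)
      fix H H' assume "H \<in> ?C" "H' \<in> ?C" "hd (w H) = hd (w H')"
      then have "w H = w H'"
        using bspec[OF w, of H] bspec[OF w, of H'] by (intro k_geodetic_unique[OF assms(2)]) auto
      then show "H = H'"
        using bspec[OF w \<open>H \<in> ?C\<close>] bspec[OF w \<open>H' \<in> ?C\<close>] by simp
    qed
    show "(\<lambda>H. hd (w H)) ` ?C \<subseteq> parcs G `` {v}"
      using w by blast
  qed (rule finite_out_neighbours[OF assms(1)])
qed

section \<open>Deleting a vertex\<close>

definition delete_vert :: "'a pair_pre_digraph \<Rightarrow> 'a \<Rightarrow> 'a pair_pre_digraph" where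
  "delete_vert G v =
     \<lparr> pverts = pverts G - {v}, parcs = {(x, y) \<in> parcs G. x \<noteq> v \<and> y \<noteq> v} \<rparr>"

lemma pair_digraph_delete_vert:
  assumes "pair_digraph G"
  shows "pair_digraph (delete_vert G v)"
proof -
  have "finite (pverts (delete_vert G v))" "finite (parcs (delete_vert G v))"
    using pair_digraphD(1,2)[OF assms]
    by (auto simp: delete_vert_def intro: rev_finite_subset)
  moreover have "fst e \<in> pverts (delete_vert G v) \<and> snd e \<in> pverts (delete_vert G v) \<and> fst e \<noteq> snd e"
    if "e \<in> parcs (delete_vert G v)" for e
    using that pair_digraphD(3-5)[OF assms] by (auto simp: delete_vert_def)
  ultimately show ?thesis
    unfolding pair_digraph_def pair_fin_digraph_def pair_fin_digraph_axioms_def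
      pair_wf_digraph_def pair_loopfree_digraph_def pair_loopfree_digraph_axioms_def
    by blast
qed

lemma wf_digraph_with_proj:
  assumes "pair_digraph G"
  shows "wf_digraph (with_proj G)"
  using pair_digraphD(3,4)[OF assms] by (auto simp: wf_digraph_def)

lemma card_delete_vert:
  "v \<in> pverts G \<Longrightarrow> card (pverts (delete_vert G v)) = card (pverts G) - 1"
  by (simp add: delete_vert_def)

text \<open>Walks that avoid \<open>v\<close> are walks of \<open>G\<close>, so uniqueness is
  inherited.\<close>

lemma k_geodetic_delete_vert:
  assumes "k_geodetic k G"
  shows "k_geodetic k (delete_vert G v)"
proof -
  have walk: "vwalk p (with_proj G)" if "vwalk p (with_proj (delete_vert G v))" for p
    using that by (auto simp: vwalk_def delete_vert_def)
  show ?thesis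
    unfolding k_geodetic_def Uniq_def
    by (intro ballI allI impI) (rule k_geodetic_unique[OF assms], auto intro: walk)
qed

text \<open>A subgraph is well-formed, so a copy without the vertex \<open>v\<close> has no arc at
  \<open>v\<close> either and survives the deletion.\<close>

lemma copies_delete_vert:
  assumes "pair_digraph G"
  shows "{H \<in> copies Z G. v \<notin> pverts H} \<subseteq> copies Z (delete_vert G v)"
proof
  fix H assume "H \<in> {H \<in> copies Z G. v \<notin> pverts H}"
  then have H: "subgraph (with_proj H) (with_proj G)" "digraph_iso (with_proj Z) (with_proj H)"
    "v \<notin> pverts H"
    by (auto simp: copies_def)
  have "x \<noteq> v \<and> y \<noteq> v" if "(x, y) \<in> parcs H" for x y
    using H(1,3) that wf_digraph.tail_in_verts[of "with_proj H" "(x, y)"]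
      wf_digraph.head_in_verts[of "with_proj H" "(x, y)"]
    by (auto simp: subgraph_def)
  then have "subgraph (with_proj H) (with_proj (delete_vert G v))"
    using H(1,3) wf_digraph_with_proj[OF pair_digraph_delete_vert[OF assms]]
    by (auto simp: subgraph_def compatible_def delete_vert_def)
  then show "H \<in> copies Z (delete_vert G v)"
    using H(2) by (simp add: copies_def)
qed

section \<open>Induction on the number of vertices\<close>

lemma copies_empty:
  assumes "pverts G = {}" "pverts Z \<noteq> {}"
  shows "copies Z G = {}"
proof -
  have False if "H \<in> copies Z G" for H
  proof -
    have "digraph_iso (with_proj Z) (with_proj H)" "pverts H = {}"
      using that assms(1) by (auto simp: copies_def subgraph_def)
    then show False
      using assms(2) by (elim digraph_iso_with_proj) auto
  qed
  then show ?thesis by blast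
qed

text \<open>Copies are split by whether they contain \<open>v\<close>. The choice of
  \<open>v\<close> stays open; small out-degree enters only in the induction.\<close>

lemma card_dicycle_copies_delete_vert:
  assumes "pair_digraph G" "k_geodetic k G"
  shows "card (copies (dicycle (k + 1)) G) \<le>
    card (copies (dicycle (k + 1)) (delete_vert G v)) + card (parcs G `` {v})"
proof -
  let ?Z = "dicycle (k + 1)"
  have "copies ?Z G = {H \<in> copies ?Z G. v \<notin> pverts H} \<union> {H \<in> copies ?Z G. v \<in> pverts H}"
    by auto
  from card_Un_le[of "{H \<in> copies ?Z G. v \<notin> pverts H}" "{H \<in> copies ?Z G. v \<in> pverts H}",
      folded this]
  have "card (copies ?Z G) \<le>
      card {H \<in> copies ?Z G. v \<notin> pverts H} + card {H \<in> copies ?Z G. v \<in> pverts H}" .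
  also have "\<dots> \<le> card (copies ?Z (delete_vert G v)) + card (parcs G `` {v})"
    using card_mono[OF copies_card_le(1)[OF pair_digraph_delete_vert] copies_delete_vert, OF assms(1) assms(1)]
      card_dicycle_copies_through[OF assms] by (rule add_mono)
  finally show ?thesis .
qed

text \<open>Deleting a suitable vertex from a digraph of order \<open>Suc n\<close> destroys at most
  \<open>Suc n powr (1 / k)\<close> copies, which is exactly the new last summand.\<close>

lemma card_dicycle_copies_le:
  assumes "k > 0" "pair_digraph G" "k_geodetic k G"
  shows "real (card (copies (dicycle (k + 1)) G)) \<le>
    (\<Sum>i = 1..card (pverts G). real i powr (1 / real k))"
  using assms(2,3)
proof (induction "card (pverts G)" arbitrary: G)
  case 0
  then have "copies (dicycle (k + 1)) G = {}"
    using pair_digraphD(1)[OF 0(2)] by (intro copies_empty) (auto simp: dicycle_def)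
  then show ?case by (simp add: sum_nonneg)
next
  case (Suc n)
  let ?Z = "dicycle (k + 1)"
  have "pverts G \<noteq> {}"
    using Suc.hyps(2) by auto
  then obtain v where v: "v \<in> pverts G" "card (parcs G `` {v}) ^ k \<le> card (pverts G)"
    by (rule k_geodetic_small_out_degree[OF Suc.prems])
  let ?D = "delete_vert G v" and ?d = "card (parcs G `` {v})"
  have n: "card (pverts ?D) = n"
    using card_delete_vert[OF v(1)] by (simp flip: Suc.hyps(2))
  have D: "real (card (copies ?Z ?D)) \<le> (\<Sum>i = 1..n. real i powr (1 / real k))"
    using Suc.hyps(1)[OF n[symmetric] pair_digraph_delete_vert[OF Suc.prems(1)]
        k_geodetic_delete_vert[OF Suc.prems(2)]]
    unfolding n .
  have "real ?d ^ k \<le> real (Suc n)"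
    using v(2) unfolding Suc.hyps(2)[symmetric] of_nat_power[symmetric] of_nat_le_iff .
  \<comment> \<open>Taking \<open>k\<close>-th roots isolates the out-degree; \<open>k > 0\<close>
    makes \<open>root k\<close> monotone and inverse to the power.\<close>
  then have "root k (real ?d ^ k) \<le> root k (real (Suc n))"
    using assms(1) by (simp only: real_root_le_iff)
  then have "real ?d \<le> root k (real (Suc n))"
    using assms(1) by (simp only: real_root_power_cancel of_nat_0_le_iff)
  then have "real ?d \<le> real (Suc n) powr (1 / real k)"
    using assms(1) by (simp add: root_powr_inverse inverse_eq_divide)
  moreover have "real (card (copies ?Z G)) \<le> real (card (copies ?Z ?D)) + real ?d"
    using card_dicycle_copies_delete_vert[OF Suc.prems, of v]
    unfolding of_nat_add[symmetric] of_nat_le_iff .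
  ultimately have "real (card (copies ?Z G)) \<le>
      (\<Sum>i = 1..n. real i powr (1 / real k)) + real (Suc n) powr (1 / real k)"
    using D by linarith
  then show ?case
    unfolding Suc.hyps(2)[symmetric] by simp
qed

text \<open>The maximum over a finite nonempty set is attained, so the bound for a single digraph
  carries over.\<close>

lemma ex_dicycle_le:
  assumes "k > 0"
  shows "real (ex n (dicycle (k + 1)) k) \<le> (\<Sum>i = 1..n. real i powr (1 / real k))"
proof -
  have "ex n (dicycle (k + 1)) k \<in> copy_numbers n (dicycle (k + 1)) k"
    unfolding ex_def by (rule Max_in[OF finite_copy_numbers copy_numbers_nonempty])
  then obtain G :: "nat pair_pre_digraph" where "pair_digraph G" "card (pverts G) = n"
      "k_geodetic k G" "ex n (dicycle (k + 1)) k = card (copies (dicycle (k + 1)) G)"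
    unfolding copy_numbers_def by blast
  then show ?thesis
    using card_dicycle_copies_le[of k G] assms by simp
qed

section \<open>Sums of fractional powers\<close>

text \<open>Mean value theorem for \<open>x powr (a + 1)\<close> on \<open>[n, n + 1]\<close>: the
  derivative \<open>(a + 1) * z powr a\<close> is monotone in \<open>z\<close>, hence lies between
  its values at the ends.\<close>

lemma powr_Suc_diff_bounds:
  fixes a :: real
  assumes "a > 0"
  shows "(a + 1) * real n powr a \<le> real (Suc n) powr (a + 1) - real n powr (a + 1)"
    and "real (Suc n) powr (a + 1) - real n powr (a + 1) \<le> (a + 1) * real (Suc n) powr a"
proof -
  have "(a + 1) * real n powr a \<le> real (Suc n) powr (a + 1) - real n powr (a + 1) \<and>
    real (Suc n) powr (a + 1) - real n powr (a + 1) \<le> (a + 1) * real (Suc n) powr a"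
  \<comment> \<open>The derivative rule for \<open>powr\<close> is applied at positive points. At
    \<open>n = 0\<close> the bounds read 0 \<le> 1 \<le> a + 1.\<close>
  proof (cases "n = 0")
    case True
    then show ?thesis using assms by simp
  next
    case False
    have "\<exists>z. real n < z \<and> z < real (Suc n) \<and> real (Suc n) powr (a + 1) - real n powr (a + 1) =
        (real (Suc n) - real n) * ((a + 1) * z powr a)"
    proof (rule MVT2)
      fix x assume "real n \<le> x"
      with False have "x > 0" by simp
      from has_real_derivative_powr[OF this, of "a + 1"]
      show "((\<lambda>x. x powr (a + 1)) has_real_derivative (a + 1) * x powr a) (at x)"
        by simp
    qed simp
    then obtain z where z: "real n < z" "z < real (Suc n)"
      "real (Suc n) powr (a + 1) - real n powr (a + 1) = (a + 1) * z powr a"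
      by auto
    have "real n powr a \<le> z powr a" "z powr a \<le> real (Suc n) powr a"
      using z assms by (auto intro!: powr_mono2)
    then show ?thesis
      unfolding z(3) using assms by (auto intro!: mult_left_mono)
  qed
  then show "(a + 1) * real n powr a \<le> real (Suc n) powr (a + 1) - real n powr (a + 1)"
    and "real (Suc n) powr (a + 1) - real n powr (a + 1) \<le> (a + 1) * real (Suc n) powr a"
    by blast+
qed

text \<open>Compares the sum with the telescoping sum of the differences of
  \<open>n powr (a + 1) / (a + 1)\<close>. These lie between \<open>n powr a\<close> and
  \<open>Suc n powr a\<close>; the extra \<open>n powr a\<close> in the upper bound absorbs the
  shift of the index by one.\<close>

lemma sum_powr_bounds:
  fixes a :: real
  assumes "a > 0"
  shows "real n powr (a + 1) / (a + 1) \<le> (\<Sum>i = 1..n. real i powr a)"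
    and "(\<Sum>i = 1..n. real i powr a) \<le> real n powr (a + 1) / (a + 1) + real n powr a"
proof (induction n)
  case 0
  case 1 then show ?case by simp
  case 2 then show ?case by simp
next
  case (Suc n)
  have diff: "real n powr a \<le> real (Suc n) powr (a + 1) / (a + 1) - real n powr (a + 1) / (a + 1)"
    "real (Suc n) powr (a + 1) / (a + 1) - real n powr (a + 1) / (a + 1) \<le> real (Suc n) powr a"
    using powr_Suc_diff_bounds[OF assms, of n] assms
    by (simp_all add: pos_le_divide_eq pos_divide_le_eq mult.commute flip: diff_divide_distrib)
  have sum: "(\<Sum>i = 1..Suc n. real i powr a) = (\<Sum>i = 1..n. real i powr a) + real (Suc n) powr a"
    by simp
  case 1
  show ?case
    unfolding sum using Suc diff(2) by linarith
  case 2
  show ?case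
    unfolding sum using Suc diff(1) by linarith
qed

lemma sum_powr_bigo:
  fixes a :: real
  assumes "a > 0"
  shows "(\<lambda>n. (\<Sum>i = 1..n. real i powr a) - real n powr (a + 1) / (a + 1)) \<in> O(\<lambda>n. real n powr a)"
\<comment> \<open>The difference lies between 0 and \<open>n powr a\<close> for every
  \<open>n\<close>, so the constant 1 works.\<close>
proof (rule bigoI[of _ 1], rule always_eventually, rule allI)
  fix n
  show "norm ((\<Sum>i = 1..n. real i powr a) - real n powr (a + 1) / (a + 1)) \<le> 1 * norm (real n powr a)"
    using sum_powr_bounds[OF assms, of n] by simp
qed

theorem theorem26:
  fixes k :: nat
  assumes "k \<ge> 2"
  shows "(\<forall>n. real (ex n (dicycle (k + 1)) k) \<le> (\<Sum>i = 1..n. real i powr (1 / real k))) \<and>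
         (\<lambda>n. (\<Sum>i = 1..n. real i powr (1 / real k))
              - real k / (real k + 1) * real n powr ((real k + 1) / real k))
           \<in> O(\<lambda>n. real n powr (1 / real k))"
proof -
  \<comment> \<open>With \<open>a = 1 / k\<close>, the exponent is \<open>a + 1\<close> and the
    leading coefficient is \<open>1 / (a + 1)\<close>.\<close>
  have "(real k + 1) / real k = 1 / real k + 1"
    "real k / (real k + 1) * x = x / (1 / real k + 1)" for x
    using assms by (auto simp: field_simps)
  then show ?thesis
    using ex_dicycle_le sum_powr_bigo[of "1 / real k"] assms by simp
qed

end
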